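(* Let $d\ge 1$, let $X\subset\mathbb{R}^d$ be convex and bounded, let $f^*:X\to\mathbb{R}$ be convex and differentiable, and let $\mathcal{N}_\theta:X\to\mathbb{R}$ be an input convex neural network, i.e. a convex differentiable function. Let $X_T\subset X$ be a finite training set, and assume that the network is trained in Sobolev norm to zero training loss, i.e. $$f^*(x_i)=\mathcal{N}_\theta(x_i),\qquad \nabla f^*(x_i)=\nabla\mathcal{N}_\theta(x_i)\qquad\text{for all }x_i\in X_T .$$ Let $X_d=\{x_0,\dots,x_d\}\subset X_T$ be $d+1$ local training points and let $x^*$ be a point in the interior of the convex hull $\mathcal{C}(X_d)$. Then $$\|\nabla f^*(x^* )-\nabla\mathcal{N}_\theta(x^* )\|_2\le\operatorname{diam}(A_{x^*})\le\max_{i\neq j}\left(\|X_i^{-1}\|+\|X_j^{-1}\|\right)C_{x^*},$$ where $$A_{x^*}=\{v\in\mathbb{R}^d : v\cdot(x_i-x^* )\le\nabla f^*(x_i)\cdot(x_i-x^* ),\ i=0,\dots,d\},$$ $$C_{x^*}=\max_{k,l\in\{0,\dots,d\}}\|\nabla f^*(x_k)-\nabla f^*(x_l)\|_2,$$ and $X_i\in\mathbb{R}^{d\times d}$ is the matrix whose rows are the normalized relative vectors $(x_j-x^* )/\|x_j-x^*\|_2$, $j\in\{0,\dots,d\}\setminus\{i\}$.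
   Context: $\cdot$ is the Euclidean inner product on $\mathbb{R}^d$, $\|\cdot\|_2$ the Euclidean norm, $\|\cdot\|_\infty$ the maximum norm, and $\operatorname{diam}$ the diameter with respect to $\|\cdot\|_2$. $\|X_i^{-1}\|$ is the operator norm of $X_i^{-1}$ as a linear map $(\mathbb{R}^d,\|\cdot\|_\infty)\to(\mathbb{R}^d,\|\cdot\|_2)$, i.e. $\sup_{\|y\|_\infty\le1}\|X_i^{-1}y\|_2$; the matrices $X_i$ are invertible in this setting. $A_{x^*}$ is the polyhedron of feasible gradients with respect to the point of interest $x^*$ and the local training points $X_d$. The condition of zero training loss refers to the loss $\frac{1}{|T|}\sum_{i\in T}\left(\|f^*(x_i)-\mathcal{N}_\theta(x_i)\|_2^2+\|\nabla f^*(x_i)-\nabla\mathcal{N}_\theta(x_i)\|_2^2\right)$, where $T$ indexes the points of $X_T$. *)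

theory Defs
  imports "HOL-Analysis.Analysis"
begin

(* The derivative is taken within X, so that it makes sense at boundary points of X. If X is
   convex with nonempty interior it is unique there (see grad_eqI), so the choice hidden in
   frechet_derivative is immaterial. *)
definition grad :: "(real ^ 'n \<Rightarrow> real) \<Rightarrow> (real ^ 'n) set \<Rightarrow> real ^ 'n \<Rightarrow> real ^ 'n" where
  "grad f X x = (\<chi> i. frechet_derivative f (at x within X) (axis i 1))"

definition sobolev_loss ::
  "(real ^ 'n \<Rightarrow> real) \<Rightarrow> (real ^ 'n \<Rightarrow> real) \<Rightarrow> (real ^ 'n) set \<Rightarrow> (real ^ 'n) set \<Rightarrow> real" where
  "sobolev_loss f N X T =
     (1 / real (card T)) *
     (\<Sum>x\<in>T. (norm (f x - N x))\<^sup>2 + (norm (grad f X x - grad N X x))\<^sup>2)"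

definition feasible_gradients ::
  "(real ^ 'n \<Rightarrow> real) \<Rightarrow> (real ^ 'n) set \<Rightarrow> (nat \<Rightarrow> real ^ 'n) \<Rightarrow> real ^ 'n \<Rightarrow> (real ^ 'n) set" where
  "feasible_gradients f X p x =
     {v. \<forall>i\<in>{0..CARD('n)}. v \<bullet> (p i - x) \<le> grad f X (p i) \<bullet> (p i - x)}"

definition gradient_spread ::
  "(real ^ 'n \<Rightarrow> real) \<Rightarrow> (real ^ 'n) set \<Rightarrow> (nat \<Rightarrow> real ^ 'n) \<Rightarrow> real" where
  "gradient_spread f X p =
     Max ((\<lambda>(k, l). norm (grad f X (p k) - grad f X (p l))) ` ({0..CARD('n)} \<times> {0..CARD('n)}))"

(* Rows are indexed by the type 'n; r lists the point indices that occur, i.e. it is a bijection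
   from 'n onto {0..d} - {i} when this is the matrix belonging to the index i. *)
definition direction_matrix ::
  "('n \<Rightarrow> nat) \<Rightarrow> (nat \<Rightarrow> real ^ 'n) \<Rightarrow> real ^ 'n \<Rightarrow> real ^ 'n ^ 'n" where
  "direction_matrix r p x = (\<chi> a. (1 / norm (p (r a) - x)) *\<^sub>R (p (r a) - x))"

definition opnorm_inf_2 :: "real ^ 'n ^ 'm \<Rightarrow> real" where
  "opnorm_inf_2 M = (SUP y\<in>{y. infnorm y \<le> 1}. norm (M *v y))"

lemma has_derivative_grad:
  assumes "f differentiable (at x within X)"
  shows "(f has_derivative (\<lambda>h. grad f X x \<bullet> h)) (at x within X)"
proof -
  let ?D = "frechet_derivative f (at x within X)"
  have D: "(f has_derivative ?D) (at x within X)"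
    using assms by (simp add: frechet_derivative_works)
  then have lin: "linear ?D"
    by (rule has_derivative_linear)
  have "?D h = grad f X x \<bullet> h" for h
  proof -
    have "?D h = ?D (\<Sum>i\<in>UNIV. h $ i *\<^sub>R axis i 1)"
      using basis_expansion[of h] by (simp add: scalar_mult_eq_scaleR)
    also have "\<dots> = (\<Sum>i\<in>UNIV. h $ i *\<^sub>R ?D (axis i 1))"
      by (simp add: linear_sum[OF lin] linear_cmul[OF lin])
    also have "\<dots> = grad f X x \<bullet> h"
      by (simp add: grad_def inner_vec_def mult.commute)
    finally show ?thesis .
  qed
  then have "?D = (\<lambda>h. grad f X x \<bullet> h)" by blast
  with D show ?thesis by simp
qed

lemma grad_eqI:
  assumes X: "convex X" "interior X \<noteq> {}" and x: "x \<in> X"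
    and g: "(f has_derivative (\<lambda>h. g \<bullet> h)) (at x within X)"
  shows "grad f X x = g"
proof -
  define w where "w = grad f X x - g"
  have D: "(f has_derivative (\<lambda>h. grad f X x \<bullet> h)) (at x within X)"
    using has_derivative_grad g by (auto simp: differentiable_def)
  have w0: "w \<bullet> (y - x) = 0" if y: "y \<in> X" for y
  proof -
    let ?q = "\<lambda>t::real. x + t *\<^sub>R (y - x)"
    have sub: "?q ` {0..1} \<subseteq> X"
    proof
      fix z assume "z \<in> ?q ` {0..1}"
      then obtain t where t: "0 \<le> t" "t \<le> 1" "z = ?q t" by auto
      then have "z = (1 - t) *\<^sub>R x + t *\<^sub>R y" by (simp add: algebra_simps)
      then show "z \<in> X" using convexD_alt[OF X(1) x y t(1,2)] by simp
    qed
    have q: "(?q has_derivative (\<lambda>t. t *\<^sub>R (y - x))) (at 0 within {0..1})"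
      by (auto intro!: derivative_eq_intros)
    have *: "((f \<circ> ?q) has_vector_derivative (v \<bullet> (y - x))) (at 0 within {0..1})"
      if "(f has_derivative (\<lambda>h. v \<bullet> h)) (at x within X)" for v
    proof -
      have "(f has_derivative (\<lambda>h. v \<bullet> h)) (at (?q 0) within ?q ` {0..1})"
        using has_derivative_subset[OF that sub] by simp
      from diff_chain_within[OF q this] show ?thesis
        by (simp add: has_vector_derivative_def o_def)
    qed
    have "at (0::real) within {0..1} \<noteq> bot"
      by (simp add: at_within_Icc_at_right)
    then have "grad f X x \<bullet> (y - x) = g \<bullet> (y - x)"
      using vector_derivative_unique_within[OF _ *[OF D] *[OF g]] by blast
    then show ?thesis by (simp add: w_def inner_diff_left)
  qed
  obtain c e where e: "e > 0" "cball c e \<subseteq> X"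
    using X(2) by (metis all_not_in_conv mem_interior_cball)
  have "w = 0"
  proof (rule ccontr)
    assume w: "w \<noteq> 0"
    have "c + (e / norm w) *\<^sub>R w \<in> cball c e" "c \<in> cball c e"
      using w e by (auto simp: dist_norm)
    then have "w \<bullet> (c + (e / norm w) *\<^sub>R w - x) = 0" "w \<bullet> (c - x) = 0"
      using w0 e(2) by blast+
    then have "(e / norm w) * (w \<bullet> w) = 0"
      by (simp add: inner_diff_right inner_add_right)
    then show False using w e by simp
  qed
  then show ?thesis by (simp add: w_def)
qed

lemma sobolev_loss_eq_0_iff:
  assumes "finite T"
  shows "sobolev_loss f N X T = 0 \<longleftrightarrow> (\<forall>x\<in>T. f x = N x \<and> grad f X x = grad N X x)"
  using assms
  by (cases "T = {}") (auto simp: sobolev_loss_def sum_nonneg_eq_0_iff add_nonneg_eq_0_iff)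

end

theory Submission
  imports Defs
begin

text \<open>
  Convexity makes the gradient monotone, so the gradient at \<open>x\<^sup>*\<close> of any convex function whose
  gradients at the \<open>x\<^sub>i\<close> are \<open>g\<^sub>i\<close> satisfies all the inequalities defining \<open>A\<close>
  (\<open>grad_mem_feasible_gradients\<close>). Zero loss gives the two functions the same \<open>g\<^sub>i\<close>, hence the same
  \<open>A\<close>, and so both gradients at \<open>x\<^sup>*\<close> lie in \<open>A\<close>. This is the first inequality as soon as \<open>A\<close> is
  bounded, which the second one contains.

  For the second inequality, write \<open>u\<^sub>j\<close> for the normalized vectors \<open>(x\<^sub>j - x\<^sup>*) / \<parallel>x\<^sub>j - x\<^sup>*\<parallel>\<close>.
  As \<open>x\<^sup>*\<close> is interior to the simplex, there is a relation \<open>\<Sum>\<^sub>j \<mu>\<^sub>j u\<^sub>j = 0\<close> with all \<open>\<mu>\<^sub>j > 0\<close>, and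
  any \<open>d\<close> of the \<open>u\<^sub>j\<close> are independent, that is, each \<open>X\<^sub>i\<close> is invertible. Let \<open>v\<^sub>i\<close> be the point at
  which the constraints with index \<open>j \<noteq> i\<close> are tight. The weighted slack
  \<open>\<Sum>\<^sub>j \<mu>\<^sub>j (g\<^sub>j - v) \<bullet> u\<^sub>j\<close> is the same for all \<open>v\<close>; so the contributions of the single constraints,
  divided by this total, are barycentric coordinates of \<open>v \<in> A\<close> with respect to the \<open>v\<^sub>i\<close>
  (\<open>polyhedron_subset_hull_vertices\<close>). Hence the diameter of \<open>A\<close> is at most the largest
  distance between two vertices.

  Finally, all \<open>v\<^sub>i\<close> are close to any one \<open>g\<^sub>k\<close>: the entries of \<open>X\<^sub>i (v\<^sub>i - g\<^sub>k)\<close> are the numbers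
  \<open>(g\<^sub>j - g\<^sub>k) \<bullet> u\<^sub>j\<close>, which are at most \<open>C\<close> in absolute value, so that
  \<open>\<parallel>v\<^sub>i - g\<^sub>k\<parallel> \<le> \<parallel>X\<^sub>i\<^sup>-\<^sup>1\<parallel> C\<close>. The triangle inequality through \<open>g\<^sub>k\<close> bounds \<open>\<parallel>v\<^sub>i - v\<^sub>j\<parallel>\<close>.
\<close>

section \<open>Gradients of convex functions\<close>

text \<open>The difference quotients along the segment from \<open>x\<close> to \<open>y\<close> are bounded by \<open>f y - f x\<close>.
  Only one-sided limits enter, so that \<open>x\<close> may lie on the boundary of \<open>X\<close>.\<close>

lemma convex_on_grad_le:
  fixes f :: "real ^ 'n \<Rightarrow> real"
  assumes f: "convex_on X f" "f differentiable (at x within X)"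
    and x: "x \<in> X" and y: "y \<in> X"
  shows "grad f X x \<bullet> (y - x) \<le> f y - f x"
proof -
  let ?q = "\<lambda>t::real. x + t *\<^sub>R (y - x)"
  have q: "?q t = (1 - t) *\<^sub>R x + t *\<^sub>R y" for t
    by (simp add: algebra_simps)
  have X: "convex X"
    using f(1) by (rule convex_on_imp_convex)
  have sub: "?q ` {0..1} \<subseteq> X"
    using convexD_alt[OF X x y] by (auto simp: q)
  have dq: "(?q has_derivative (\<lambda>t. t *\<^sub>R (y - x))) (at 0 within {0..1})"
    by (auto intro!: derivative_eq_intros)
  have "(f has_derivative (\<lambda>h. grad f X x \<bullet> h)) (at (?q 0) within ?q ` {0..1})"
    using has_derivative_subset[OF has_derivative_grad[OF f(2)] sub] by simp
  from diff_chain_within[OF dq this]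
  have "((\<lambda>t. f (?q t)) has_derivative (\<lambda>t. t * (grad f X x \<bullet> (y - x)))) (at 0 within {0..1})"
    by (simp add: o_def)
  then have "((\<lambda>t. f (?q t)) has_field_derivative grad f X x \<bullet> (y - x)) (at 0 within {0..1})"
    by (simp add: has_field_derivative_def mult_commute_abs)
  then have lim: "((\<lambda>t. (f (?q t) - f x) / t) \<longlongrightarrow> grad f X x \<bullet> (y - x)) (at 0 within {0..1})"
    by (simp add: has_field_derivative_iff)
  have le: "(f (?q t) - f x) / t \<le> f y - f x" if "0 < t" "t \<le> 1" for t
  proof -
    have "f (?q t) \<le> (1 - t) * f x + t * f y"
      unfolding q using convex_onD[OF f(1)] that x y by simp
    with \<open>0 < t\<close> show ?thesis
      by (simp add: field_simps)
  qed
  have "\<forall>\<^sub>F t in at 0 within {0..1}. (f (?q t) - f x) / t \<le> f y - f x"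
    by (auto simp: eventually_at_filter le less_le)
  moreover have "at (0::real) within {0..1} \<noteq> bot"
    by (simp add: at_within_Icc_at_right)
  ultimately show ?thesis
    using tendsto_upperbound[OF lim] by blast
qed

lemma convex_on_grad_mono:
  fixes f :: "real ^ 'n \<Rightarrow> real"
  assumes "convex_on X f" "f differentiable_on X" "x \<in> X" "y \<in> X"
  shows "grad f X x \<bullet> (y - x) \<le> grad f X y \<bullet> (y - x)"
  using convex_on_grad_le[of X f x y] convex_on_grad_le[of X f y x] assms
  by (simp add: differentiable_on_def inner_diff_right)

lemma grad_mem_feasible_gradients:
  fixes f :: "real ^ 'n \<Rightarrow> real"
  assumes "convex_on X f" "f differentiable_on X" "x \<in> X" "p ` {0..CARD('n)} \<subseteq> X"
  shows "grad f X x \<in> feasible_gradients f X p x"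
  using convex_on_grad_mono[OF assms(1-3)] assms(4)
  by (auto simp: feasible_gradients_def)

section \<open>The operator norm from the maximum norm to the Euclidean norm\<close>

lemma infnorm_leI_cart:
  fixes y :: "real ^ 'n"
  assumes "\<And>a. \<bar>y $ a\<bar> \<le> c"
  shows "infnorm y \<le> c"
  unfolding infnorm_cart using assms by (auto intro: cSup_least)

lemma bdd_above_opnorm_inf_2:
  fixes M :: "real ^ 'n ^ 'm"
  shows "bdd_above ((\<lambda>y. norm (M *v y)) ` {y. infnorm y \<le> 1})"
proof (rule bdd_aboveI2)
  fix y :: "real ^ 'n"
  assume "y \<in> {y. infnorm y \<le> 1}"
  then have "sqrt DIM(real ^ 'n) * infnorm y \<le> sqrt DIM(real ^ 'n)"
    by (intro mult_left_le) simp_all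
  then have "norm y \<le> sqrt DIM(real ^ 'n)"
    using norm_le_infnorm[of y] by (rule order_trans[rotated])
  then show "norm (M *v y) \<le> onorm ((*v) M) * sqrt DIM(real ^ 'n)"
    using onorm[OF matrix_vector_mul_bounded_linear, of M y]
      mult_left_mono[OF _ onorm_pos_le[OF matrix_vector_mul_bounded_linear, of M]]
    by (meson order_trans)
qed

lemma opnorm_inf_2_nonneg: "0 \<le> opnorm_inf_2 M"
  unfolding opnorm_inf_2_def
  using cSUP_upper[OF _ bdd_above_opnorm_inf_2, of 0 M] by (simp add: infnorm_0)

lemma norm_le_opnorm_inf_2:
  fixes M :: "real ^ 'n ^ 'm"
  assumes "infnorm y \<le> c"
  shows "norm (M *v y) \<le> opnorm_inf_2 M * c"
proof (cases "c = 0")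
  case True
  then have "y = 0"
    using assms infnorm_pos_le[of y] infnorm_eq_0[of y] by simp
  with True show ?thesis by simp
next
  case False
  then have c: "0 < c"
    using assms infnorm_pos_le[of y] by linarith
  have "infnorm ((1 / c) *\<^sub>R y) \<le> 1"
    using assms c by (simp add: infnorm_mul field_simps)
  then have "norm (M *v ((1 / c) *\<^sub>R y)) \<le> opnorm_inf_2 M"
    unfolding opnorm_inf_2_def by (intro cSUP_upper bdd_above_opnorm_inf_2) simp
  then show ?thesis
    using c by (simp add: matrix_vector_mult_scaleR field_simps)
qed

lemma matrix_inv:
  assumes "invertible M"
  shows "matrix_inv M ** M = mat 1" and "M ** matrix_inv M = mat 1"
  using someI_ex[OF assms[unfolded invertible_def]] by (simp_all add: matrix_inv_def)

section \<open>A point in the interior of a simplex\<close>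

text \<open>The relative interior of a hull consists of the strictly positive combinations; interior
  points belong to it.\<close>

lemma interior_convex_hull_image_positive:
  fixes p :: "'i \<Rightarrow> 'a::euclidean_space"
  assumes "finite I" "x \<in> interior (convex hull (p ` I))"
  obtains l where "\<And>i. i \<in> I \<Longrightarrow> 0 < l i" "sum l I = 1" "(\<Sum>i\<in>I. l i *\<^sub>R p i) = x"
proof -
  have "x \<in> rel_interior (convex hull (\<Union>i\<in>I. {p i}))"
    using assms(2) interior_subset_rel_interior by (auto simp: UNION_singleton_eq_range)
  then obtain c s where "\<forall>i\<in>I. 0 < c i" "sum c I = 1" "\<forall>i\<in>I. s i \<in> {p i}"
      "x = (\<Sum>i\<in>I. c i *\<^sub>R s i)"
    by (subst (asm) rel_interior_convex_hull_union[OF assms(1)]) auto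
  then show thesis
    by (intro that[of c]) auto
qed

text \<open>The functional \<open>z \<mapsto> y \<bullet> z\<close> takes the value \<open>y \<bullet> x\<close> on all of \<open>S\<close>, hence on its hull, which
  contains a ball around \<open>x\<close>.\<close>

lemma orthogonal_to_interior_convex_hull:
  fixes y :: "'a::euclidean_space"
  assumes x: "x \<in> interior (convex hull S)" and orth: "\<And>z. z \<in> S \<Longrightarrow> y \<bullet> (z - x) = 0"
  shows "y = 0"
proof (rule ccontr)
  assume y: "y \<noteq> 0"
  have "S \<subseteq> {z. y \<bullet> z = y \<bullet> x}"
    using orth by (auto simp: inner_diff_right)
  then have hull: "convex hull S \<subseteq> {z. y \<bullet> z = y \<bullet> x}"
    by (intro hull_minimal convex_hyperplane)
  obtain e where e: "e > 0" "cball x e \<subseteq> convex hull S"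
    using x by (auto simp: mem_interior_cball)
  have "x + (e / norm y) *\<^sub>R y \<in> cball x e"
    using y e by (auto simp: dist_norm)
  then have "y \<bullet> (x + (e / norm y) *\<^sub>R y) = y \<bullet> x"
    using e hull by blast
  then show False
    using y e by (simp add: inner_add_right)
qed

locale simplex_interior_point =
  fixes I :: "nat set" and p :: "nat \<Rightarrow> real ^ 'n" and x :: "real ^ 'n" and r :: "nat \<Rightarrow> 'n \<Rightarrow> nat"
  assumes finite_I: "finite I"
    and interior: "x \<in> interior (convex hull (p ` I))"
    and r: "\<And>i. i \<in> I \<Longrightarrow> bij_betw (r i) UNIV (I - {i})"
begin

definition u :: "nat \<Rightarrow> real ^ 'n" where
  "u j = (1 / norm (p j - x)) *\<^sub>R (p j - x)"

lemma I_nonempty: "I \<noteq> {}"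
  using interior by auto

lemma r_mem: "i \<in> I \<Longrightarrow> r i a \<in> I - {i}"
  using r[of i] by (auto simp: bij_betw_def)

lemma r_surj:
  assumes "i \<in> I" "j \<in> I" "j \<noteq> i"
  obtains a where "j = r i a"
proof -
  have "j \<in> range (r i)"
    using assms r[of i] by (simp add: bij_betw_def)
  then show thesis
    using that by blast
qed

text \<open>If \<open>p i\<close> were \<open>x\<close>, then the other \<open>d\<close> vectors \<open>p j - x\<close> would satisfy the nontrivial relation
  given by the barycentric coordinates of \<open>x\<close>. They would be the rows of a singular square matrix, and a
  vector in its kernel would be orthogonal to the whole simplex.\<close>

lemma vertex_neq:
  assumes i: "i \<in> I"
  shows "p i \<noteq> x"
proof
  assume eq: "p i = x"
  obtain l where l: "\<And>i. i \<in> I \<Longrightarrow> 0 < l i" "sum l I = 1" "(\<Sum>i\<in>I. l i *\<^sub>R p i) = x"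
    using interior_convex_hull_image_positive[OF finite_I interior] by blast
  define M :: "real ^ 'n ^ 'n" where "M = (\<chi> a. p (r i a) - x)"
  have "(\<Sum>a\<in>UNIV. l (r i a) *\<^sub>R (p (r i a) - x)) = (\<Sum>j\<in>I - {i}. l j *\<^sub>R (p j - x))"
    by (rule sum.reindex_bij_betw[OF r[OF i]])
  also have "\<dots> = (\<Sum>j\<in>I. l j *\<^sub>R (p j - x))"
    using i eq by (simp add: sum.remove[OF finite_I i])
  also have "\<dots> = 0"
    using l by (simp add: scaleR_diff_right sum_subtractf flip: scaleR_left.sum)
  finally have "(\<Sum>a\<in>UNIV. l (r i a) *\<^sub>R (p (r i a) - x)) = 0" .
  moreover have "row a M = p (r i a) - x" for a
    by (simp add: M_def row_def vec_eq_iff)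
  ultimately have "(\<Sum>a\<in>UNIV. l (r i a) *s row a M) = 0"
    by (simp add: scalar_mult_eq_scaleR)
  moreover have "l (r i a) \<noteq> 0" for a
    using l(1)[of "r i a"] r_mem[OF i, of a] by auto
  ultimately have "\<not> (\<exists>B. M ** B = mat 1)"
    by (auto simp: matrix_right_invertible_independent_rows)
  then have "\<not> (\<exists>B. B ** M = mat 1)"
    using matrix_left_right_inverse by blast
  then obtain y where y: "M *v y = 0" "y \<noteq> 0"
    by (auto simp: matrix_left_invertible_ker)
  have "y \<bullet> (p j - x) = 0" if "j \<in> I" for j
  proof (cases "j = i")
    case False
    with i that obtain a where "j = r i a"
      using r_surj by blast
    then show ?thesis
      using arg_cong[OF y(1), of "\<lambda>z. z $ a"]
      by (simp add: M_def matrix_vector_mul_component inner_commute)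
  qed (simp add: eq)
  then have "y = 0"
    by (intro orthogonal_to_interior_convex_hull[OF interior]) auto
  with y(2) show False ..
qed

lemma norm_u: "j \<in> I \<Longrightarrow> norm (u j) = 1"
  using vertex_neq by (simp add: u_def)

lemma inner_u_le_iff: "j \<in> I \<Longrightarrow> v \<bullet> u j \<le> w \<bullet> u j \<longleftrightarrow> v \<bullet> (p j - x) \<le> w \<bullet> (p j - x)"
  using vertex_neq by (simp add: u_def divide_le_cancel)

lemma eq_0_if_orthogonal_u:
  assumes "\<And>j. j \<in> I \<Longrightarrow> y \<bullet> u j = 0"
  shows "y = 0"
  using assms vertex_neq
  by (intro orthogonal_to_interior_convex_hull[OF interior]) (fastforce simp: u_def)

text \<open>Rescaled barycentric coordinates of \<open>x\<close>.\<close>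

lemma positive_relation_u:
  obtains m where "\<And>j. j \<in> I \<Longrightarrow> 0 < m j" "(\<Sum>j\<in>I. m j *\<^sub>R u j) = 0"
proof -
  obtain l where l: "\<And>i. i \<in> I \<Longrightarrow> 0 < l i" "sum l I = 1" "(\<Sum>i\<in>I. l i *\<^sub>R p i) = x"
    using interior_convex_hull_image_positive[OF finite_I interior] by blast
  have "(\<Sum>j\<in>I. (l j * norm (p j - x)) *\<^sub>R u j) = (\<Sum>j\<in>I. l j *\<^sub>R (p j - x))"
    by (intro sum.cong) (auto simp: u_def vertex_neq)
  also have "\<dots> = 0"
    using l by (simp add: scaleR_diff_right sum_subtractf flip: scaleR_left.sum)
  finally show thesis
    using l(1) vertex_neq by (intro that[of "\<lambda>j. l j * norm (p j - x)"]) auto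
qed

lemma direction_matrix_component: "(direction_matrix (r i) p x *v y) $ a = y \<bullet> u (r i a)"
  by (simp add: direction_matrix_def u_def matrix_vector_mul_component inner_commute)

text \<open>A vector orthogonal to all \<open>u j\<close> with \<open>j \<noteq> i\<close> is also orthogonal to \<open>u i\<close>, because the
  coefficient of \<open>u i\<close> in the positive relation does not vanish.\<close>

lemma invertible_direction_matrix:
  assumes i: "i \<in> I"
  shows "invertible (direction_matrix (r i) p x)"
  unfolding invertible_left_inverse matrix_left_invertible_ker
proof (intro allI impI)
  fix y
  assume y: "direction_matrix (r i) p x *v y = 0"
  have other: "y \<bullet> u j = 0" if "j \<in> I" "j \<noteq> i" for j
    using r_surj[OF i that] direction_matrix_component[of i y] y by (metis zero_index)
  obtain m where m: "\<And>j. j \<in> I \<Longrightarrow> 0 < m j" "(\<Sum>j\<in>I. m j *\<^sub>R u j) = 0"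
    by (rule positive_relation_u) blast
  have "0 = (\<Sum>j\<in>I. m j * (y \<bullet> u j))"
    using arg_cong[OF m(2), of "inner y"] by (simp add: inner_sum_right)
  also have "\<dots> = m i * (y \<bullet> u i)"
    by (simp add: sum.remove[OF finite_I i] other)
  finally have "y \<bullet> u i = 0"
    using m(1)[OF i] by simp
  with other show "y = 0"
    by (metis eq_0_if_orthogonal_u)
qed

section \<open>The polyhedron of feasible gradients\<close>

context
  fixes g :: "nat \<Rightarrow> real ^ 'n"
begin

definition vertex :: "nat \<Rightarrow> real ^ 'n" where
  "vertex i = matrix_inv (direction_matrix (r i) p x) *v (\<chi> a. g (r i a) \<bullet> u (r i a))"

lemma vertex_tight:
  assumes "i \<in> I" "j \<in> I" "j \<noteq> i"
  shows "vertex i \<bullet> u j = g j \<bullet> u j"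
proof -
  obtain a where a: "j = r i a"
    using assms by (rule r_surj)
  have "direction_matrix (r i) p x *v vertex i = (\<chi> a. g (r i a) \<bullet> u (r i a))"
    by (simp add: vertex_def matrix_vector_mul_assoc
        matrix_inv(2)[OF invertible_direction_matrix[OF assms(1)]])
  then show ?thesis
    using direction_matrix_component[of i "vertex i" a] a by simp
qed

text \<open>With \<open>\<Sigma> = \<Sum>\<^sub>j \<mu>\<^sub>j (g\<^sub>j \<bullet> u\<^sub>j)\<close>, the weighted slack \<open>\<mu>\<^sub>j ((g\<^sub>j - v) \<bullet> u\<^sub>j)\<close> of constraint
  \<open>j\<close> is \<open>\<Sigma>\<close> at the vertex \<open>j\<close> and \<open>0\<close> at the other vertices, and the weighted slacks of any \<open>v\<close> add up
  to \<open>\<Sigma>\<close>. So \<open>v\<close> and the combination of the vertices with coefficients \<open>\<mu>\<^sub>j ((g\<^sub>j - v) \<bullet> u\<^sub>j) / \<Sigma>\<close>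
  have the same slacks, and slacks determine a vector. If \<open>\<Sigma> = 0\<close>, the polyhedron is a single point
  with which all vertices coincide.\<close>

lemma polyhedron_subset_hull_vertices:
  assumes v: "\<And>j. j \<in> I \<Longrightarrow> v \<bullet> u j \<le> g j \<bullet> u j"
  shows "v \<in> convex hull (vertex ` I)"
proof -
  obtain m where m: "\<And>j. j \<in> I \<Longrightarrow> 0 < m j" "(\<Sum>j\<in>I. m j *\<^sub>R u j) = 0"
    by (rule positive_relation_u) blast
  define S where "S = (\<Sum>j\<in>I. m j * (g j \<bullet> u j))"
  define s where "s w j = m j * ((g j - w) \<bullet> u j)" for w j
  have sum_s: "(\<Sum>j\<in>I. s w j) = S" for w
  proof -
    have "(\<Sum>j\<in>I. m j * (w \<bullet> u j)) = 0"
      using arg_cong[OF m(2), of "inner w"] by (simp add: inner_sum_right)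
    then show ?thesis
      by (simp add: s_def S_def inner_diff_left right_diff_distrib sum_subtractf)
  qed
  have s_nonneg: "0 \<le> s v j" if "j \<in> I" for j
    using v[OF that] m(1)[OF that] by (simp add: s_def inner_diff_left)
  have s_vertex: "s (vertex i) j = (if j = i then S else 0)" if i: "i \<in> I" and j: "j \<in> I" for i j
  proof -
    have other: "s (vertex i) k = 0" if "k \<in> I" "k \<noteq> i" for k
      using vertex_tight[OF i that] by (simp add: s_def inner_diff_left)
    have "S = s (vertex i) i"
      using sum_s[of "vertex i"] by (simp add: sum.remove[OF finite_I i] other)
    with other j show ?thesis by simp
  qed
  have eqI: "w = w'" if "\<And>j. j \<in> I \<Longrightarrow> s w j = s w' j" for w w'
  proof -
    have "(w - w') \<bullet> u j = 0" if "j \<in> I" for j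
      using \<open>\<And>j. j \<in> I \<Longrightarrow> s w j = s w' j\<close>[OF that] m(1)[OF that]
      by (simp add: s_def inner_diff_left)
    then show ?thesis
      using eq_0_if_orthogonal_u[of "w - w'"] by simp
  qed
  show ?thesis
  proof (cases "S = 0")
    case True
    then have "s v j = 0" if "j \<in> I" for j
      using sum_s[of v] s_nonneg that by (simp add: sum_nonneg_eq_0_iff finite_I)
    moreover obtain i where i: "i \<in> I"
      using I_nonempty by blast
    ultimately have "v = vertex i"
      using s_vertex[OF i] True by (intro eqI) auto
    then show ?thesis
      using i by (auto intro: hull_inc)
  next
    case False
    have "0 \<le> S"
      using sum_s[of v] s_nonneg by (metis sum_nonneg)
    let ?w = "\<Sum>i\<in>I. (s v i / S) *\<^sub>R vertex i"
    have coeffs: "(\<Sum>i\<in>I. s v i / S) = 1"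
      using sum_s[of v] False by (simp flip: sum_divide_distrib)
    have "s ?w j = s v j" if j: "j \<in> I" for j
    proof -
      have "g j \<bullet> u j = (\<Sum>i\<in>I. (s v i / S) * (g j \<bullet> u j))"
        using coeffs by (simp only: mult_1 flip: sum_distrib_right)
      then have "s ?w j = m j * ((\<Sum>i\<in>I. (s v i / S) * (g j \<bullet> u j))
                            - (\<Sum>i\<in>I. (s v i / S) * (vertex i \<bullet> u j)))"
        by (simp add: s_def inner_diff_left inner_sum_left)
      also have "\<dots> = (\<Sum>i\<in>I. (s v i / S) * s (vertex i) j)"
        by (simp add: s_def inner_diff_left sum_distrib_left algebra_simps sum_subtractf)
      also have "\<dots> = (\<Sum>i\<in>I. if i = j then s v j else 0)"
        using False j by (intro sum.cong) (auto simp: s_vertex)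
      finally show ?thesis
        using j by (simp add: finite_I)
    qed
    then have "v = ?w"
      by (intro eqI) simp
    also have "?w \<in> convex hull (vertex ` I)"
      using coeffs s_nonneg \<open>0 \<le> S\<close>
      by (intro convex_sum finite_I convex_convex_hull) (auto intro: hull_inc)
    finally show ?thesis .
  qed
qed

lemma vertex_near:
  assumes i: "i \<in> I" and c: "\<And>j. j \<in> I \<Longrightarrow> norm (g j - w) \<le> c"
  shows "norm (vertex i - w) \<le> opnorm_inf_2 (matrix_inv (direction_matrix (r i) p x)) * c"
proof -
  let ?M = "direction_matrix (r i) p x"
  have "infnorm (?M *v (vertex i - w)) \<le> c"
  proof (rule infnorm_leI_cart)
    fix a
    have j: "r i a \<in> I" "r i a \<noteq> i"
      using r_mem[OF i, of a] by auto
    have "(?M *v (vertex i - w)) $ a = (g (r i a) - w) \<bullet> u (r i a)"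
      using vertex_tight[OF i j] by (simp add: direction_matrix_component inner_diff_left)
    also have "\<bar>\<dots>\<bar> \<le> norm (g (r i a) - w)"
      using Cauchy_Schwarz_ineq2[of "g (r i a) - w" "u (r i a)"] norm_u[OF j(1)] by simp
    finally show "\<bar>(?M *v (vertex i - w)) $ a\<bar> \<le> c"
      using c[OF j(1)] by linarith
  qed
  then have "norm (matrix_inv ?M *v (?M *v (vertex i - w))) \<le> opnorm_inf_2 (matrix_inv ?M) * c"
    by (rule norm_le_opnorm_inf_2)
  then show ?thesis
    by (simp add: matrix_vector_mul_assoc matrix_inv(1)[OF invertible_direction_matrix[OF i]])
qed

lemma polyhedron_dist_le:
  assumes v: "\<And>j. j \<in> I \<Longrightarrow> v \<bullet> u j \<le> g j \<bullet> u j"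
    and w: "\<And>j. j \<in> I \<Longrightarrow> w \<bullet> u j \<le> g j \<bullet> u j"
    and c: "\<And>k l. k \<in> I \<Longrightarrow> l \<in> I \<Longrightarrow> norm (g k - g l) \<le> c"
  shows "norm (v - w) \<le>
      Max {opnorm_inf_2 (matrix_inv (direction_matrix (r i) p x))
             + opnorm_inf_2 (matrix_inv (direction_matrix (r j) p x)) | i j.
           i \<in> I \<and> j \<in> I \<and> i \<noteq> j} * c"
    (is "_ \<le> Max {?o i + ?o j | i j. ?P i j} * c")
proof -
  let ?K = "{?o i + ?o j | i j. ?P i j}"
  have "?K \<subseteq> (\<lambda>(i, j). ?o i + ?o j) ` (I \<times> I)"
    by auto
  then have "finite ?K"
    by (rule finite_subset) (simp add: finite_I)
  then have K: "?o i + ?o j \<le> Max ?K" if "i \<in> I" "j \<in> I" "i \<noteq> j" for i j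
    using that by (intro Max_ge) auto
  obtain k where k: "k \<in> I"
    using I_nonempty by blast
  have "0 \<le> c"
    using c[OF k k] by simp
  have near: "norm (vertex i - g k) \<le> ?o i * c" if "i \<in> I" for i
    using that c k by (intro vertex_near) auto
  obtain i j where ij: "i \<in> I" "j \<in> I" and vw: "norm (v - w) \<le> norm (vertex i - vertex j)"
    using simplex_extremal_le[of "vertex ` I"] finite_I I_nonempty
      polyhedron_subset_hull_vertices[OF v] polyhedron_subset_hull_vertices[OF w]
    by fastforce
  show ?thesis
  proof (cases "i = j")
    case True
    have "?o k + ?o (r k undefined) \<le> Max ?K"
      using r_mem[OF k, of undefined] k by (intro K) auto
    then have "0 \<le> Max ?K"
      using opnorm_inf_2_nonneg[of "matrix_inv (direction_matrix (r k) p x)"]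
        opnorm_inf_2_nonneg[of "matrix_inv (direction_matrix (r (r k undefined)) p x)"] by linarith
    then have "0 \<le> Max ?K * c"
      using \<open>0 \<le> c\<close> by (rule mult_nonneg_nonneg)
    with True vw show ?thesis by simp
  next
    case False
    have "norm (v - w) \<le> norm (vertex i - g k) + norm (vertex j - g k)"
      using vw norm_triangle_ineq4[of "vertex i - g k" "vertex j - g k"] by simp
    also have "\<dots> \<le> (?o i + ?o j) * c"
      using near ij by (simp add: distrib_right add_mono)
    also have "\<dots> \<le> Max ?K * c"
      using K[OF ij False] \<open>0 \<le> c\<close> by (rule mult_right_mono)
    finally show ?thesis .
  qed
qed

end

end

section \<open>The error bound\<close>

lemma norm_grad_diff_le_gradient_spread:
  fixes p :: "nat \<Rightarrow> real ^ 'n"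
  assumes "k \<in> {0..CARD('n)}" "l \<in> {0..CARD('n)}"
  shows "norm (grad f X (p k) - grad f X (p l)) \<le> gradient_spread f X p"
  unfolding gradient_spread_def using assms by (intro Max_ge) force+

theorem mainTheorem3:
  fixes X XT :: "(real ^ 'n) set"
    and f N :: "real ^ 'n \<Rightarrow> real"
    and p :: "nat \<Rightarrow> real ^ 'n"
    and xstar :: "real ^ 'n"
    and r :: "nat \<Rightarrow> 'n \<Rightarrow> nat"
  assumes "convex X" and "bounded X"
    and "convex_on X f" and "f differentiable_on X"
    and "convex_on X N" and "N differentiable_on X"
    and "finite XT" and "XT \<subseteq> X"
    and "sobolev_loss f N X XT = 0"
    and "inj_on p {0..CARD('n)}" and "p ` {0..CARD('n)} \<subseteq> XT"
    and "xstar \<in> interior (convex hull (p ` {0..CARD('n)}))"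
    and "\<And>i. i \<in> {0..CARD('n)} \<Longrightarrow> bij_betw (r i) UNIV ({0..CARD('n)} - {i})"
  shows "norm (grad f X xstar - grad N X xstar) \<le> diameter (feasible_gradients f X p xstar)
    \<and> diameter (feasible_gradients f X p xstar) \<le>
      Max {opnorm_inf_2 (matrix_inv (direction_matrix (r i) p xstar))
             + opnorm_inf_2 (matrix_inv (direction_matrix (r j) p xstar)) | i j.
           i \<in> {0..CARD('n)} \<and> j \<in> {0..CARD('n)} \<and> i \<noteq> j}
        * gradient_spread f X p"
    (is "_ \<and> _ \<le> ?B")
proof -
  interpret simplex_interior_point "{0..CARD('n)}" p xstar r
    using assms(12,13) by unfold_locales simp_all
  let ?A = "feasible_gradients f X p xstar"
  have pX: "p ` {0..CARD('n)} \<subseteq> X"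
    using assms(8,11) by blast
  have "convex hull (p ` {0..CARD('n)}) \<subseteq> X"
    using pX assms(1) by (rule hull_minimal)
  then have x: "xstar \<in> X"
    using assms(12) interior_subset by blast
  have "grad f X (p i) = grad N X (p i)" if "i \<in> {0..CARD('n)}" for i
    using assms(9,11) that sobolev_loss_eq_0_iff[OF assms(7), of f N X] by blast
  then have "?A = feasible_gradients N X p xstar"
    by (simp add: feasible_gradients_def)
  then have mem: "grad f X xstar \<in> ?A" "grad N X xstar \<in> ?A"
    using grad_mem_feasible_gradients[OF _ _ x pX] assms(3-6) by blast+
  have dist: "norm (v - w) \<le> ?B" if "v \<in> ?A" "w \<in> ?A" for v w
    using that
    by (intro polyhedron_dist_le[where g = "\<lambda>i. grad f X (p i)"] norm_grad_diff_le_gradient_spread)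
      (simp_all add: feasible_gradients_def inner_u_le_iff)
  have "bounded ?A"
    using dist[OF mem(1)] by (auto simp: bounded_def dist_norm)
  then have "norm (grad f X xstar - grad N X xstar) \<le> diameter ?A"
    using diameter_bounded_bound mem by (metis dist_norm)
  moreover have "diameter ?A \<le> ?B"
    using mem(1) dist by (intro diameter_le) auto
  ultimately show ?thesis ..
qed

end
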